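(* Let $n$ be a positive integer and let $\Lambda=(\lambda_G)_{G\subseteq K_n}$ be an OCC spectrum with $\lambda_\emptyset=1$, with minimal value $\lambda_{\min}$ satisfying $-1<\lambda_{\min}<0$, and with spectral gap $\gamma>0$. Set $\nu=\frac{-\lambda_{\min}}{1-\lambda_{\min}}$. Then for any odd-cycle-agreeing family $\mathcal{F}$ of subgraphs of $K_n$: (1) $\mu(\mathcal{F})\le\nu$; (2) if $\mu(\mathcal{F})=\nu$ then $\widehat{\mathcal{F}}(G)\ne0$ only for $G\in\Lambda_{\min}\cup\{\emptyset\}$; (3) letting $w=\sum_{G\notin\Lambda_{\min}\cup\{\emptyset\}}\widehat{\mathcal{F}}(G)^2$, we have $w\le\frac{\nu}{(1-\nu)\gamma}(\nu-\mu(\mathcal{F}))$.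
   Context: Subgraphs of $K_n$ are identified with subsets of $X=[n]^{(2)}$, and the set of all of them with the group $\mathbb{Z}_2^{X}$ under symmetric difference $\oplus$; $\overline{G}$ is the complement of $G$ in $K_n$. $\mu$ is the uniform probability measure on subgraphs of $K_n$, and $\langle f,g\rangle=2^{-|X|}\sum_S f(S)g(S)$. For $R\subseteq X$, $\chi_R(S)=(-1)^{|R\cap S|}$; these form an orthonormal (Fourier–Walsh) basis, and $\widehat f(R)=\langle f,\chi_R\rangle$. A family $\mathcal{F}$ is identified with its indicator function, so $\widehat{\mathcal{F}}(G)=\langle 1_{\mathcal{F}},\chi_G\rangle$. A family $\mathcal{F}$ is odd-cycle-agreeing if for all $G,H\in\mathcal{F}$, $\overline{G\oplus H}$ contains an odd cycle. A linear operator $A$ on real functions on $\mathbb{Z}_2^X$ is OCC if (i) whenever $f$ is the indicator of an odd-cycle-agreeing family, $f(G)=1$ implies $Af(G)=0$, and (ii) every $\chi_R$ is an eigenfunction of $A$. Its OCC spectrum is $(\lambda_G)_{G\subseteq K_n}$ with $A\chi_G=\lambda_G\chi_G$. $\lambda_{\min}$ is the minimum eigenvalue, $\Lambda_{\min}=\{G:\lambda_G=\lambda_{\min}\}$, and the spectral gap is the maximal $\gamma$ such that $\lambda_H\ge\lambda_{\min}+\gamma$ for all $H\notin\Lambda_{\min}$. *)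

theory Defs
  imports "HOL-Analysis.Analysis"
begin

definition Kn :: "nat \<Rightarrow> nat set set" where
  "Kn n = {e. e \<subseteq> {1..n} \<and> card e = 2}"

definition gcompl :: "nat \<Rightarrow> nat set set \<Rightarrow> nat set set" where
  "gcompl n G = Kn n - G"

text \<open>A cycle is given by the list of its (distinct) vertices in cyclic order.\<close>

definition contains_odd_cycle :: "nat set set \<Rightarrow> bool" where
  "contains_odd_cycle G \<longleftrightarrow>
     (\<exists>vs. distinct vs \<and> length vs \<ge> 3 \<and> odd (length vs) \<and>
        (\<forall>i < length vs. {vs ! i, vs ! (Suc i mod length vs)} \<in> G))"

definition odd_cycle_agreeing :: "nat \<Rightarrow> nat set set set \<Rightarrow> bool" where
  "odd_cycle_agreeing n \<F> \<longleftrightarrow>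
     \<F> \<subseteq> Pow (Kn n) \<and>
     (\<forall>G\<in>\<F>. \<forall>H\<in>\<F>. contains_odd_cycle (gcompl n (sym_diff G H)))"

definition gmeasure :: "nat \<Rightarrow> nat set set set \<Rightarrow> real" where
  "gmeasure n \<F> = measure (uniform_count_measure (Pow (Kn n))) \<F>"

text \<open>
  A real function on the subgraphs of \<open>K\<^sub>n\<close> is represented by its extension by zero to
  all of \<^typ>\<open>nat set set\<close>, so that equality of functions is equality on subgraphs.  The
  indicator of a family of subgraphs has this form already.
\<close>

definition gfuns :: "nat \<Rightarrow> (nat set set \<Rightarrow> real) set" where
  "gfuns n = {f. \<forall>S. S \<notin> Pow (Kn n) \<longrightarrow> f S = 0}"

definition ginner :: "nat \<Rightarrow> (nat set set \<Rightarrow> real) \<Rightarrow> (nat set set \<Rightarrow> real) \<Rightarrow> real" where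
  "ginner n f g = (\<Sum>S\<in>Pow (Kn n). f S * g S) / 2 ^ card (Kn n)"

definition walsh :: "nat \<Rightarrow> nat set set \<Rightarrow> nat set set \<Rightarrow> real" where
  "walsh n R S = (if S \<in> Pow (Kn n) then (-1) ^ card (R \<inter> S) else 0)"

definition fourier :: "nat \<Rightarrow> (nat set set \<Rightarrow> real) \<Rightarrow> nat set set \<Rightarrow> real" where
  "fourier n f R = ginner n f (walsh n R)"

definition linear_operator ::
  "nat \<Rightarrow> ((nat set set \<Rightarrow> real) \<Rightarrow> (nat set set \<Rightarrow> real)) \<Rightarrow> bool" where
  "linear_operator n A \<longleftrightarrow>
     (\<forall>f\<in>gfuns n. A f \<in> gfuns n) \<and>
     (\<forall>f\<in>gfuns n. \<forall>g\<in>gfuns n. A (\<lambda>S. f S + g S) = (\<lambda>S. A f S + A g S)) \<and>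
     (\<forall>c. \<forall>f\<in>gfuns n. A (\<lambda>S. c * f S) = (\<lambda>S. c * A f S))"

definition eigenfunction ::
  "nat \<Rightarrow> ((nat set set \<Rightarrow> real) \<Rightarrow> (nat set set \<Rightarrow> real)) \<Rightarrow> real \<Rightarrow> (nat set set \<Rightarrow> real) \<Rightarrow> bool"
where
  "eigenfunction n A c f \<longleftrightarrow> f \<in> gfuns n \<and> f \<noteq> (\<lambda>_. 0) \<and> A f = (\<lambda>S. c * f S)"

definition OCC_operator ::
  "nat \<Rightarrow> ((nat set set \<Rightarrow> real) \<Rightarrow> (nat set set \<Rightarrow> real)) \<Rightarrow> bool" where
  "OCC_operator n A \<longleftrightarrow>
     linear_operator n A \<and>
     (\<forall>\<F>. odd_cycle_agreeing n \<F> \<longrightarrow>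
        (\<forall>G\<in>Pow (Kn n). indicator \<F> G = (1::real) \<longrightarrow> A (indicator \<F>) G = 0)) \<and>
     (\<forall>R\<in>Pow (Kn n). \<exists>c. eigenfunction n A c (walsh n R))"

text \<open>Only the values of \<open>lam\<close> on subgraphs of \<open>K\<^sub>n\<close> matter below.\<close>

definition OCC_spectrum :: "nat \<Rightarrow> (nat set set \<Rightarrow> real) \<Rightarrow> bool" where
  "OCC_spectrum n lam \<longleftrightarrow>
     (\<exists>A. OCC_operator n A \<and> (\<forall>G\<in>Pow (Kn n). A (walsh n G) = (\<lambda>S. lam G * walsh n G S)))"

definition spec_min :: "nat \<Rightarrow> (nat set set \<Rightarrow> real) \<Rightarrow> real" where
  "spec_min n lam = Min (lam ` Pow (Kn n))"

definition spec_argmin :: "nat \<Rightarrow> (nat set set \<Rightarrow> real) \<Rightarrow> nat set set set" where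
  "spec_argmin n lam = {G \<in> Pow (Kn n). lam G = spec_min n lam}"

text \<open>The maximum exists whenever \<open>lam\<close> is not constant on the subgraphs of \<open>K\<^sub>n\<close>.\<close>

definition spectral_gap :: "nat \<Rightarrow> (nat set set \<Rightarrow> real) \<Rightarrow> real" where
  "spectral_gap n lam =
     (GREATEST \<gamma>. \<forall>H \<in> Pow (Kn n) - spec_argmin n lam. lam H \<ge> spec_min n lam + \<gamma>)"

lemma finite_Kn: "finite (Kn n)"
  by (rule finite_subset[of _ "Pow {1..n}"]) (auto simp: Kn_def)

lemma spectral_gap_eq_Min:
  assumes "Pow (Kn n) - spec_argmin n lam \<noteq> {}"
  shows "spectral_gap n lam = Min ((\<lambda>H. lam H - spec_min n lam) ` (Pow (Kn n) - spec_argmin n lam))"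
proof -
  have fin: "finite (Pow (Kn n) - spec_argmin n lam)"
    by (simp add: finite_Kn)
  show ?thesis
    unfolding spectral_gap_def
  proof (rule Greatest_equality)
    show "\<forall>H \<in> Pow (Kn n) - spec_argmin n lam. lam H \<ge> spec_min n lam +
        Min ((\<lambda>H. lam H - spec_min n lam) ` (Pow (Kn n) - spec_argmin n lam))"
    proof
      fix H assume "H \<in> Pow (Kn n) - spec_argmin n lam"
      then have "Min ((\<lambda>H. lam H - spec_min n lam) ` (Pow (Kn n) - spec_argmin n lam))
          \<le> lam H - spec_min n lam"
        using fin by (intro Min_le) auto
      then show "lam H \<ge> spec_min n lam +
          Min ((\<lambda>H. lam H - spec_min n lam) ` (Pow (Kn n) - spec_argmin n lam))"
        by linarith
    qed
  next
    fix y :: real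
    assume y: "\<forall>H \<in> Pow (Kn n) - spec_argmin n lam. lam H \<ge> spec_min n lam + y"
    have "y \<le> x" if "x \<in> (\<lambda>H. lam H - spec_min n lam) ` (Pow (Kn n) - spec_argmin n lam)" for x
    proof -
      from that obtain H where H: "H \<in> Pow (Kn n) - spec_argmin n lam"
        and x: "x = lam H - spec_min n lam"
        by (rule imageE)
      from y H have "spec_min n lam + y \<le> lam H" by (rule bspec)
      then show ?thesis unfolding x by linarith
    qed
    then show "y \<le> Min ((\<lambda>H. lam H - spec_min n lam) ` (Pow (Kn n) - spec_argmin n lam))"
      using fin assms by (intro Min.boundedI) auto
  qed
qed

end

theory Submission
  imports Defs
begin

text \<open>
  The argument is Hoffman's ratio bound.  If \<open>f\<close> is the indicator of \<open>\<F>\<close> and \<open>A\<close> an OCC operator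
  with the given spectrum, then \<open>\<langle>f, A f\<rangle> = 0\<close>, which in the Walsh basis reads
  \<open>\<Sum>\<^sub>G \<lambda>\<^sub>G f\<^sub>G\<^sup>2 = 0\<close> with \<open>f\<^sub>G\<close> the Fourier coefficients.  Since \<open>f\<close> takes values 0 and 1,
  \<open>\<Sum>\<^sub>G f\<^sub>G\<^sup>2 = f\<^sub>\<emptyset> = \<mu>\<close>.  Estimating \<open>\<lambda>\<^sub>G\<close> from below by the minimum, and by the
  minimum plus the gap off the minimisers, gives
  \<open>\<gamma> w \<le> (1 - \<lambda>\<^sub>m\<^sub>i\<^sub>n) \<mu> (\<nu> - \<mu>)\<close>, from which all three claims follow.
\<close>

text \<open>Writing the character as a product over the edges of \<open>R\<close> lets a sum over
  all \<open>R\<close> factor edge by edge.\<close>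

lemma neg_one_power_card_eq_prod:
  assumes "finite R"
  shows "(-1 :: 'a::comm_ring_1) ^ card (R \<inter> S) = (\<Prod>e\<in>R. if e \<in> S then -1 else 1)"
  using assms by (simp add: prod.If_cases Int_def)

text \<open>Orthogonality in the dual direction: the sum runs over the index \<open>R\<close>, with
  the points \<open>S\<close> and \<open>T\<close> fixed. Summing \<open>prod g R\<close> over all
  subsets \<open>R\<close> expands the product of the factors \<open>g e + 1\<close>. Each factor is
  2 where \<open>S\<close> and \<open>T\<close> agree on \<open>e\<close>, and 0 where they
  differ.\<close>

lemma walsh_completeness:
  assumes "S \<in> Pow (Kn n)" "T \<in> Pow (Kn n)"
  shows "(\<Sum>R\<in>Pow (Kn n). walsh n R S * walsh n R T) = (if S = T then 2 ^ card (Kn n) else 0)"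
proof -
  define g :: "nat set \<Rightarrow> real"
    where "g = (\<lambda>e. (if e \<in> S then -1 else 1) * (if e \<in> T then -1 else 1))"
  have "(\<Sum>R\<in>Pow (Kn n). walsh n R S * walsh n R T) = (\<Sum>R\<in>Pow (Kn n). prod g R)"
  proof (rule sum.cong)
    fix R assume "R \<in> Pow (Kn n)"
    then have "finite R" using finite_Kn finite_subset by auto
    then show "walsh n R S * walsh n R T = prod g R"
      using assms
      by (simp add: walsh_def neg_one_power_card_eq_prod g_def prod.distrib del: prod_constant)
  qed simp
  also have "\<dots> = (\<Prod>e\<in>Kn n. g e + 1)"
    by (simp add: prod_add finite_Kn)
  also have "\<dots> = (if S = T then 2 ^ card (Kn n) else 0)"
  proof (cases "S = T")
    case True
    then have "(\<Prod>e\<in>Kn n. g e + 1) = (\<Prod>e\<in>Kn n. 2)"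
      by (intro prod.cong) (auto simp: g_def)
    with True show ?thesis by simp
  next
    case False
    then obtain e where "e \<in> Kn n" "e \<in> S \<longleftrightarrow> e \<notin> T" using assms by blast
    then have "e \<in> Kn n" "g e + 1 = 0" by (auto simp: g_def)
    then have "(\<Prod>e\<in>Kn n. g e + 1) = 0" by (intro prod_zero) (auto simp: finite_Kn)
    with False show ?thesis by simp
  qed
  finally show ?thesis .
qed

text \<open>Exchanging the two sums leaves the completeness kernel, which picks out the term
  \<open>T = S\<close>. Outside \<open>Pow (Kn n)\<close> both sides vanish by the extension-by-zero
  convention.\<close>

lemma fourier_inversion:
  assumes "f \<in> gfuns n"
  shows "f = (\<lambda>S. \<Sum>R\<in>Pow (Kn n). fourier n f R * walsh n R S)"
proof
  fix S
  show "f S = (\<Sum>R\<in>Pow (Kn n). fourier n f R * walsh n R S)"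
  proof (cases "S \<in> Pow (Kn n)")
    case True
    let ?N = "2 ^ card (Kn n) :: real"
    have "(\<Sum>R\<in>Pow (Kn n). fourier n f R * walsh n R S)
        = (\<Sum>R\<in>Pow (Kn n). \<Sum>T\<in>Pow (Kn n). f T / ?N * (walsh n R T * walsh n R S))"
      by (simp add: fourier_def ginner_def sum_divide_distrib sum_distrib_right mult.assoc)
    also have "\<dots> = (\<Sum>T\<in>Pow (Kn n). f T / ?N * (\<Sum>R\<in>Pow (Kn n). walsh n R T * walsh n R S))"
      by (subst sum.swap) (simp add: sum_distrib_left)
    also have "\<dots> = (\<Sum>T\<in>Pow (Kn n). if T = S then f T else 0)"
      using True by (intro sum.cong refl) (simp add: walsh_completeness del: Pow_iff)
    also have "\<dots> = f S"
      using True by (simp add: finite_Kn)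
    finally show ?thesis by simp
  next
    case False
    with assms show ?thesis by (simp add: gfuns_def walsh_def)
  qed
qed

lemma ginner_sum_walsh:
  "ginner n f (\<lambda>S. \<Sum>R\<in>Pow (Kn n). c R * walsh n R S) = (\<Sum>R\<in>Pow (Kn n). c R * fourier n f R)"
proof -
  have "ginner n f (\<lambda>S. \<Sum>R\<in>Pow (Kn n). c R * walsh n R S)
      = (\<Sum>S\<in>Pow (Kn n). \<Sum>R\<in>Pow (Kn n). c R * (f S * walsh n R S) / 2 ^ card (Kn n))"
    unfolding ginner_def
    by (simp add: sum_divide_distrib sum_distrib_left mult_ac del: Pow_iff)
  also have "\<dots> = (\<Sum>R\<in>Pow (Kn n). c R * fourier n f R)"
    by (subst sum.swap)
      (simp add: fourier_def ginner_def sum_divide_distrib sum_distrib_left del: Pow_iff)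
  finally show ?thesis .
qed

text \<open>Only the second argument is expanded; pairing it with \<open>f\<close> produces the
  coefficients of \<open>f\<close> again.\<close>

lemma parseval:
  assumes "f \<in> gfuns n"
  shows "ginner n f f = (\<Sum>R\<in>Pow (Kn n). (fourier n f R)\<^sup>2)"
  using arg_cong[OF fourier_inversion[OF assms], of "ginner n f"]
  by (simp only: ginner_sum_walsh power2_eq_square)

lemma linear_operator_sum:
  assumes A: "linear_operator n A" and "finite I" and g: "\<And>i. i \<in> I \<Longrightarrow> g i \<in> gfuns n"
  shows "A (\<lambda>S. \<Sum>i\<in>I. c i * g i S) = (\<lambda>S. \<Sum>i\<in>I. c i * A (g i) S)"
  using assms(2) g
proof (induction I rule: finite_induct)
  case empty
  have "(\<lambda>_. 0) \<in> gfuns n" by (simp add: gfuns_def)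
  \<comment> \<open>The empty sum is the zero function; homogeneity with scalar 0 shows that
    \<open>A\<close> maps it to zero.\<close>
  moreover have "\<forall>f\<in>gfuns n. A (\<lambda>S. 0 * f S) = (\<lambda>S. 0 * A f S)"
    using A unfolding linear_operator_def by blast
  ultimately show ?case by auto
next
  case (insert i I)
  have mem: "(\<lambda>S. c i * g i S) \<in> gfuns n" "(\<lambda>S. \<Sum>i\<in>I. c i * g i S) \<in> gfuns n"
    using insert.prems by (auto simp: gfuns_def)
  have "\<forall>f\<in>gfuns n. \<forall>g\<in>gfuns n. A (\<lambda>S. f S + g S) = (\<lambda>S. A f S + A g S)"
    using A by (simp add: linear_operator_def)
  from bspec[OF bspec[OF this mem(1)] mem(2)]
  have "A (\<lambda>S. c i * g i S + (\<Sum>i\<in>I. c i * g i S))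
      = (\<lambda>S. A (\<lambda>S. c i * g i S) S + A (\<lambda>S. \<Sum>i\<in>I. c i * g i S) S)" .
  moreover have "A (\<lambda>S. c i * g i S) = (\<lambda>S. c i * A (g i) S)"
    using A insert.prems unfolding linear_operator_def by blast
  ultimately show ?case
    using insert by simp
qed

text \<open>Two evaluations of \<open>ginner n ?f (A ?f)\<close>: the Walsh expansion gives the
  weighted sum, while pointwise the product is 0, since \<open>A ?f\<close> vanishes on
  \<open>\<F>\<close> and \<open>?f\<close> vanishes off it.\<close>

lemma OCC_spectrum_sum_fourier:
  assumes "OCC_spectrum n lam" and \<F>: "odd_cycle_agreeing n \<F>"
  shows "(\<Sum>G\<in>Pow (Kn n). lam G * (fourier n (indicator \<F>) G)\<^sup>2) = 0"
proof -
  let ?f = "indicator \<F> :: nat set set \<Rightarrow> real"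
  obtain A where A: "OCC_operator n A"
    and eig: "\<And>G. G \<in> Pow (Kn n) \<Longrightarrow> A (walsh n G) = (\<lambda>S. lam G * walsh n G S)"
    using assms(1) unfolding OCC_spectrum_def by blast
  have lin: "linear_operator n A"
    using A by (simp add: OCC_operator_def)
  have f: "?f \<in> gfuns n"
    using \<F> by (auto simp: odd_cycle_agreeing_def gfuns_def indicator_def)
  have "A ?f = A (\<lambda>S. \<Sum>R\<in>Pow (Kn n). fourier n ?f R * walsh n R S)"
    by (rule arg_cong[OF fourier_inversion[OF f], of A])
  also have "\<dots> = (\<lambda>S. \<Sum>R\<in>Pow (Kn n). fourier n ?f R * A (walsh n R) S)"
    by (rule linear_operator_sum[OF lin]) (auto simp: finite_Kn gfuns_def walsh_def)
  also have "\<dots> = (\<lambda>S. \<Sum>R\<in>Pow (Kn n). (lam R * fourier n ?f R) * walsh n R S)"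
    by (intro ext sum.cong) (simp_all add: eig)
  finally have "ginner n ?f (A ?f) = (\<Sum>G\<in>Pow (Kn n). lam G * fourier n ?f G * fourier n ?f G)"
    by (simp only: ginner_sum_walsh)
  then have "ginner n ?f (A ?f) = (\<Sum>G\<in>Pow (Kn n). lam G * (fourier n ?f G)\<^sup>2)"
    by (simp only: power2_eq_square mult.assoc)
  moreover have "ginner n ?f (A ?f) = 0"
  proof -
    have "?f G * A ?f G = 0" if "G \<in> Pow (Kn n)" for G
      using A \<F> that unfolding OCC_operator_def
      by (cases "G \<in> \<F>") (auto simp: indicator_def)
    then show ?thesis unfolding ginner_def by (subst sum.neutral) auto
  qed
  ultimately show ?thesis by simp
qed

lemma gmeasure_eq_ginner:
  assumes "\<F> \<subseteq> Pow (Kn n)"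
  shows "gmeasure n \<F> = ginner n (indicator \<F>) (indicator \<F>)"
    and "gmeasure n \<F> = fourier n (indicator \<F>) {}"
proof -
  have "finite (Pow (Kn n))" by (simp add: finite_Kn)
  then have gm: "gmeasure n \<F> = real (card \<F>) / 2 ^ card (Kn n)"
    using assms unfolding gmeasure_def
    by (subst measure_uniform_count_measure) (auto simp: card_Pow finite_Kn)
  have card: "(\<Sum>S\<in>Pow (Kn n). indicator \<F> S) = real (card \<F>)"
    using assms by (simp add: indicator_def sum.If_cases finite_Kn Int_absorb1)
  show "gmeasure n \<F> = ginner n (indicator \<F>) (indicator \<F>)"
    \<comment> \<open>The indicator is idempotent: its square is the indicator of the intersection
      of \<open>\<F>\<close> with itself.\<close>
    using card by (simp add: gm ginner_def indicator_inter_arith[symmetric])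
  show "gmeasure n \<F> = fourier n (indicator \<F>) {}"
  proof -
    have "(\<Sum>S\<in>Pow (Kn n). indicator \<F> S * walsh n {} S) = (\<Sum>S\<in>Pow (Kn n). indicator \<F> S)"
      by (intro sum.cong) (simp_all add: walsh_def)
    then show ?thesis by (simp only: gm fourier_def ginner_def card)
  qed
qed

lemma spec_min_le:
  assumes "G \<in> Pow (Kn n)"
  shows "spec_min n lam \<le> lam G"
  using assms unfolding spec_min_def by (intro Min_le) (auto simp: finite_Kn)

text \<open>The given \<open>G\<close> makes the set of non-minimisers nonempty, so the gap is a
  genuine minimum.\<close>

lemma spec_min_add_gap_le:
  assumes "G \<in> Pow (Kn n) - spec_argmin n lam"
  shows "spec_min n lam + spectral_gap n lam \<le> lam G"
proof -
  have "spectral_gap n lam \<le> lam G - spec_min n lam"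
    using assms by (subst spectral_gap_eq_Min) (auto simp: finite_Kn intro!: Min_le)
  then show ?thesis by linarith
qed

theorem theorem2p1:
  fixes n :: nat
    and lam :: "nat set set \<Rightarrow> real"
    and lmin \<gamma> \<nu> :: real
    and \<F> :: "nat set set set"
  assumes "n > 0"
    and "OCC_spectrum n lam"
    and "lam {} = 1"
    and "lmin = spec_min n lam"
    and "-1 < lmin" and "lmin < 0"
    and "\<gamma> = spectral_gap n lam" and "\<gamma> > 0"
    and "\<nu> = - lmin / (1 - lmin)"
    and "odd_cycle_agreeing n \<F>"
  shows "gmeasure n \<F> \<le> \<nu> \<and>
    (gmeasure n \<F> = \<nu> \<longrightarrow>
      (\<forall>G\<in>Pow (Kn n). fourier n (indicator \<F>) G \<noteq> 0 \<longrightarrow> G \<in> spec_argmin n lam \<union> {{}})) \<and>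
    (\<Sum>G\<in>Pow (Kn n) - (spec_argmin n lam \<union> {{}}). (fourier n (indicator \<F>) G)\<^sup>2)
      \<le> \<nu> / ((1 - \<nu>) * \<gamma>) * (\<nu> - gmeasure n \<F>)"
proof -
  define \<mu> where "\<mu> = gmeasure n \<F>"
  define a where "a G = (fourier n (indicator \<F>) G)\<^sup>2" for G
  define W where "W = Pow (Kn n) - (spec_argmin n lam \<union> {{}})"
  define w where "w = sum a W"
  have sub: "\<F> \<subseteq> Pow (Kn n)"
    using assms(10) by (simp add: odd_cycle_agreeing_def)
  have fin: "finite (Pow (Kn n))" by (simp add: finite_Kn)
  have W: "W \<subseteq> Pow (Kn n) - {{}}" by (auto simp: W_def)
  have finW: "finite W" using W fin finite_subset by blast
  have a0: "a {} = \<mu>\<^sup>2"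
    by (simp add: a_def \<mu>_def gmeasure_eq_ginner(2)[OF sub])
  have "(indicator \<F> :: _ \<Rightarrow> real) \<in> gfuns n"
    using sub by (auto simp: gfuns_def indicator_def)
  then have "sum a (Pow (Kn n)) = \<mu>"
    by (simp add: a_def \<mu>_def gmeasure_eq_ginner(1)[OF sub] parseval)
  then have rest: "sum a (Pow (Kn n) - {{}}) = \<mu> - \<mu>\<^sup>2"
    using sum.remove[OF fin, of "{}" a] by (simp add: a0)
  have "(\<Sum>G\<in>Pow (Kn n). lam G * a G) = 0"
    using OCC_spectrum_sum_fourier[OF assms(2,10)] by (simp add: a_def)
  then have lam_rest: "(\<Sum>G\<in>Pow (Kn n) - {{}}. lam G * a G) = - \<mu>\<^sup>2"
    using sum.remove[OF fin, of "{}" "\<lambda>G. lam G * a G"] by (simp add: a0 assms(3))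
  \<comment> \<open>The empty graph, with eigenvalue 1, has been split off. Every other eigenvalue
    is at least \<open>lmin\<close>, and the extra \<open>\<gamma>\<close> is credited exactly on
    \<open>W\<close>, the nonempty non-minimisers.\<close>
  have "lmin * (\<mu> - \<mu>\<^sup>2) + \<gamma> * w
      = (\<Sum>G\<in>Pow (Kn n) - {{}}. lmin * a G + (if G \<in> W then \<gamma> * a G else 0))"
  proof -
    have "(\<Sum>G\<in>Pow (Kn n) - {{}}. if G \<in> W then \<gamma> * a G else 0) = \<gamma> * w"
      using W fin by (simp add: sum.If_cases Int_absorb1 w_def sum_distrib_left)
    then show ?thesis
      by (simp add: sum.distrib rest[symmetric] sum_distrib_left)
  qed
  also have "\<dots> \<le> (\<Sum>G\<in>Pow (Kn n) - {{}}. lam G * a G)"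
  proof (rule sum_mono)
    fix G assume G: "G \<in> Pow (Kn n) - {{}}"
    have "lmin + (if G \<in> W then \<gamma> else 0) \<le> lam G"
      using G spec_min_le[of G n lam] spec_min_add_gap_le[of G n lam] assms(4,7)
      by (auto simp: W_def)
    then have "(lmin + (if G \<in> W then \<gamma> else 0)) * a G \<le> lam G * a G"
      by (rule mult_right_mono) (simp add: a_def)
    then show "lmin * a G + (if G \<in> W then \<gamma> * a G else 0) \<le> lam G * a G"
      by (simp add: distrib_right split: if_splits)
  qed
  finally have "\<gamma> * w \<le> - \<mu>\<^sup>2 - lmin * (\<mu> - \<mu>\<^sup>2)"
    using lam_rest by linarith
  also have "\<dots> = (1 - lmin) * \<mu> * (\<nu> - \<mu>)"
  proof -
    \<comment> \<open>This identity makes \<open>\<nu>\<close> the nonzero root of the quadratic in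
      \<open>\<mu>\<close>.\<close>
    have "(1 - lmin) * \<nu> = - lmin" using assms(6,9) by simp
    then show ?thesis by algebra
  qed
  finally have key: "\<gamma> * w \<le> (1 - lmin) * \<mu> * (\<nu> - \<mu>)" .
  have w0: "0 \<le> w" by (simp add: w_def a_def sum_nonneg)
  have \<mu>0: "0 \<le> \<mu>" by (simp add: \<mu>_def gmeasure_def)
  have \<nu>0: "0 < \<nu>" using assms(6,9) by (simp add: divide_neg_pos)
  have \<nu>1: "1 - \<nu> = 1 / (1 - lmin)" using assms(6,9) by (simp add: field_simps)
  have le: "\<mu> \<le> \<nu>"
  proof (rule ccontr)
    \<comment> \<open>Then \<open>\<mu>\<close> is positive, so the right side of \<open>key\<close>
      is negative while its left side is not.\<close>
    assume "\<not> \<mu> \<le> \<nu>"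
    then have "(1 - lmin) * \<mu> * (\<nu> - \<mu>) < 0"
      using \<nu>0 assms(6) by (intro mult_pos_neg mult_pos_pos) auto
    moreover have "0 \<le> \<gamma> * w" using w0 assms(8) by simp
    ultimately show False using key by linarith
  qed
  \<comment> \<open>The factor \<open>\<mu>\<close> is relaxed to \<open>\<nu>\<close>, so that the
    bound becomes linear in the deficit \<open>\<nu> - \<mu>\<close>.\<close>
  have "(1 - lmin) * \<mu> * (\<nu> - \<mu>) \<le> (1 - lmin) * \<nu> * (\<nu> - \<mu>)"
    using le assms(6) by (intro mult_right_mono mult_left_mono) auto
  with key have "\<gamma> * w \<le> (1 - lmin) * \<nu> * (\<nu> - \<mu>)" by linarith
  then have "w \<le> (1 - lmin) * \<nu> * (\<nu> - \<mu>) / \<gamma>"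
    using assms(8) by (simp add: pos_le_divide_eq mult.commute)
  also have "\<dots> = \<nu> / ((1 - \<nu>) * \<gamma>) * (\<nu> - \<mu>)"
    by (simp add: \<nu>1)
  finally have bound: "w \<le> \<nu> / ((1 - \<nu>) * \<gamma>) * (\<nu> - \<mu>)" .
  have "G \<in> spec_argmin n lam \<union> {{}}"
    if "\<mu> = \<nu>" "G \<in> Pow (Kn n)" "fourier n (indicator \<F>) G \<noteq> 0" for G
  proof (rule ccontr)
    assume "G \<notin> spec_argmin n lam \<union> {{}}"
    then have "G \<in> W" using that(2) by (simp add: W_def)
    \<comment> \<open>With zero deficit the stability bound forces \<open>w = 0\<close>, hence every
      square in the sum vanishes.\<close>
    moreover have "sum a W = 0" using bound w0 that(1) by (simp add: w_def)
    ultimately have "a G = 0"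
      using finW by (subst (asm) sum_nonneg_eq_0_iff) (auto simp: a_def)
    with that(3) show False by (simp add: a_def)
  qed
  with le bound show ?thesis
    unfolding \<mu>_def w_def W_def a_def by blast
qed

end
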